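(* For each integer $n \geq 3$, there exist graphs $G_1$ and $G_2$ such that $\chi(G_1)=1$, $\chi^{\mathrm{FAT}}(G_1)=n$, $\chi(G_2)=n$, and $\chi^{\mathrm{FAT}}(G_2)=1$.
   Context: All graphs are simple with a finite nonempty vertex set. $\chi(G)$ denotes the chromatic number of $G$. For a vertex $v$ and a set $S\subseteq V(G)$, let $e(v,S)=|S\cap N(v)|$, where $N(v)$ is the set of neighbors of $v$ and $\deg(v)=|N(v)|$. A (not necessarily proper) vertex coloring of $G$ with color classes $V_1,\dots,V_k$ is a Fair And Tolerant (FAT) $k$-coloring if $V_1,\dots,V_k$ are all nonempty, they partition $V(G)$, and there exist real numbers $\alpha,\beta\in[0,1]$ such that for every vertex $v$ and every $i\in\{1,\dots,k\}$: $e(v,V_i)=\alpha\deg(v)$ if $v\notin V_i$, and $e(v,V_i)=\beta\deg(v)$ if $v\in V_i$. The FAT chromatic number $\chi^{\mathrm{FAT}}(G)$ is the maximum $k$ such that $G$ admits a FAT $k$-coloring (a FAT $1$-coloring always exists). *)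

theory Defs
  imports Complex_Main "HOL-Library.Disjoint_Sets" "Graph_Theory.Pair_Digraph"
begin

text \<open>
  The locale \<^locale>\<open>pair_graph\<close> describes finite simple graphs: every edge is represented by its
  two opposite arcs. It permits an empty vertex set, which is excluded here.
\<close>

definition simple_graph :: "'a pair_pre_digraph \<Rightarrow> bool" where
  "simple_graph G \<longleftrightarrow> pair_graph G \<and> pverts G \<noteq> {}"

definition neighbors :: "'a pair_pre_digraph \<Rightarrow> 'a \<Rightarrow> 'a set" where
  "neighbors G v = {u. (v, u) \<in> parcs G}"

definition deg :: "'a pair_pre_digraph \<Rightarrow> 'a \<Rightarrow> nat" where
  "deg G v = card (neighbors G v)"

definition edges_to :: "'a pair_pre_digraph \<Rightarrow> 'a \<Rightarrow> 'a set \<Rightarrow> nat" where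
  "edges_to G v S = card (S \<inter> neighbors G v)"

definition proper_coloring :: "'a pair_pre_digraph \<Rightarrow> nat \<Rightarrow> ('a \<Rightarrow> nat) \<Rightarrow> bool" where
  "proper_coloring G k c \<longleftrightarrow>
     c ` pverts G \<subseteq> {1..k} \<and> (\<forall>(u, v) \<in> parcs G. c u \<noteq> c v)"

definition chromatic_number :: "'a pair_pre_digraph \<Rightarrow> nat" where
  "chromatic_number G = (LEAST k. \<exists>c. proper_coloring G k c)"

definition FAT_coloring :: "'a pair_pre_digraph \<Rightarrow> nat \<Rightarrow> (nat \<Rightarrow> 'a set) \<Rightarrow> bool" where
  "FAT_coloring G k V \<longleftrightarrow>
     (\<forall>i \<in> {1..k}. V i \<noteq> {}) \<and>
     disjoint_family_on V {1..k} \<and>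
     (\<Union>i \<in> {1..k}. V i) = pverts G \<and>
     (\<exists>\<alpha> \<in> {0..1::real}. \<exists>\<beta> \<in> {0..1::real}.
        \<forall>v \<in> pverts G. \<forall>i \<in> {1..k}.
          (v \<notin> V i \<longrightarrow> real (edges_to G v (V i)) = \<alpha> * real (deg G v)) \<and>
          (v \<in> V i \<longrightarrow> real (edges_to G v (V i)) = \<beta> * real (deg G v)))"

definition FAT_chromatic_number :: "'a pair_pre_digraph \<Rightarrow> nat" where
  "FAT_chromatic_number G = Max {k. \<exists>V. FAT_coloring G k V}"

text \<open>
  The minimum and the maximum above are attained for every simple graph.
\<close>

lemma simple_graph_proper_coloring_exists:
  assumes "simple_graph G"
  shows "\<exists>c. proper_coloring G (card (pverts G)) c"
proof -
  interpret pair_graph G using assms by (simp add: simple_graph_def)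
  obtain c where c: "bij_betw c (pverts G) {1..card (pverts G)}"
    using finite_same_card_bij[OF pair_finite_verts, of "{1..card (pverts G)}"] by auto
  have "c u \<noteq> c v" if "(u, v) \<in> parcs G" for u v
    using that c in_arcsD1[OF that] in_arcsD2[OF that] no_loops'[OF that]
    by (auto simp: bij_betw_def inj_on_def)
  with c have "proper_coloring G (card (pverts G)) c"
    by (auto simp: proper_coloring_def bij_betw_def)
  then show ?thesis by blast
qed

lemma simple_graph_FAT_1_coloring:
  assumes "simple_graph G"
  shows "FAT_coloring G 1 (\<lambda>_. pverts G)"
proof -
  interpret pair_graph G using assms by (simp add: simple_graph_def)
  have "pverts G \<inter> neighbors G v = neighbors G v" for v
    using in_arcsD2 by (auto simp: neighbors_def)
  then show ?thesis
    using assms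
    by (auto simp: FAT_coloring_def simple_graph_def disjoint_family_on_def edges_to_def deg_def
        intro!: bexI[of _ "1::real"])
qed

lemma FAT_coloring_le_card:
  assumes "simple_graph G" "FAT_coloring G k V"
  shows "k \<le> card (pverts G)"
proof -
  interpret pair_graph G using assms by (simp add: simple_graph_def)
  have V: "\<forall>i\<in>{1..k}. V i \<noteq> {}" "disjoint_family_on V {1..k}" "(\<Union>i\<in>{1..k}. V i) = pverts G"
    using assms by (auto simp: FAT_coloring_def)
  define f where "f i = (SOME x. x \<in> V i)" for i
  have f: "\<forall>i\<in>{1..k}. f i \<in> V i"
    using V(1) by (auto simp: f_def some_in_eq)
  have "inj_on f {1..k}"
  proof (rule inj_onI)
    fix i j assume "i \<in> {1..k}" "j \<in> {1..k}" "f i = f j"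
    then show "i = j"
      using f V(2) unfolding disjoint_family_on_def by (metis IntI empty_iff)
  qed
  moreover have "f ` {1..k} \<subseteq> pverts G" using f V(3) by blast
  ultimately have "card {1..k} \<le> card (pverts G)"
    by (rule card_inj_on_le) (rule pair_finite_verts)
  then show ?thesis by simp
qed

lemma FAT_chromatic_number_attained:
  assumes "simple_graph G"
  shows "\<exists>V. FAT_coloring G (FAT_chromatic_number G) V"
    and "FAT_coloring G k V \<Longrightarrow> k \<le> FAT_chromatic_number G"
proof -
  let ?K = "{k. \<exists>V. FAT_coloring G k V}"
  have fin: "finite ?K"
    by (rule finite_subset[of _ "{..card (pverts G)}"]) (use FAT_coloring_le_card[OF assms] in auto)
  have "?K \<noteq> {}" using simple_graph_FAT_1_coloring[OF assms] by blast
  from Max_in[OF fin this] show "\<exists>V. FAT_coloring G (FAT_chromatic_number G) V"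
    by (simp add: FAT_chromatic_number_def)
  show "k \<le> FAT_chromatic_number G" if "FAT_coloring G k V"
    unfolding FAT_chromatic_number_def using that by (intro Max_ge[OF fin]) blast
qed

end

theory Submission
  imports Defs
begin

text \<open>
  For \<open>G1\<close> take \<open>n\<close> isolated vertices: all degrees vanish, so every partition is a FAT coloring.
  For \<open>G2\<close> take the complete graph on \<open>n\<close> vertices with a pendant vertex. A leaf forces
  \<open>\<alpha>\<close> and \<open>\<beta>\<close> of a FAT coloring with at least two classes to be \<open>0\<close> or \<open>1\<close>. If \<open>\<alpha> = 0\<close>, the classes
  are unions of connected components, which is impossible in a connected graph; if \<open>\<alpha> = 1\<close>
  and \<open>\<beta> = 0\<close>, the coloring is proper with two colors, which a triangle excludes.
\<close>

lemma chromatic_number_eqI: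
  assumes "proper_coloring G k c" and "\<And>l d. proper_coloring G l d \<Longrightarrow> k \<le> l"
  shows "chromatic_number G = k"
  unfolding chromatic_number_def using assms by (intro Least_equality) blast+

lemma FAT_chromatic_number_eqI:
  assumes "simple_graph G" "FAT_coloring G k V" and "\<And>l W. FAT_coloring G l W \<Longrightarrow> l \<le> k"
  shows "FAT_chromatic_number G = k"
  using FAT_chromatic_number_attained[OF assms(1)] assms(2,3) by (metis le_antisym)

text \<open>Symmetry lets the condition on arcs mention only the tail: the head of an arc is the
  tail of the reversed arc, and finiteness of the arcs follows from that of the vertices.\<close>

lemma simple_graphI:
  assumes "finite (pverts G)" "pverts G \<noteq> {}"
    and "\<And>u v. (u, v) \<in> parcs G \<Longrightarrow> u \<in> pverts G \<and> u \<noteq> v \<and> (v, u) \<in> parcs G"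
  shows "simple_graph G"
proof -
  have sub: "parcs G \<subseteq> pverts G \<times> pverts G"
    using assms(3) by auto
  interpret pair_wf_digraph G
    using sub by unfold_locales auto
  have "finite (parcs G)"
    using sub assms(1) by (auto intro: finite_subset)
  moreover have "sym (parcs G)"
    using assms(3) by (auto intro: symI)
  ultimately have "pair_graph G"
    using assms by unfold_locales (auto simp: symmetric_def)
  then show ?thesis
    using assms(2) by (simp add: simple_graph_def)
qed

definition edgeless_graph :: "nat \<Rightarrow> nat pair_pre_digraph" where
  "edgeless_graph n = \<lparr>pverts = {..<n}, parcs = {}\<rparr>"

lemma simple_graph_edgeless_graph: "n \<ge> 1 \<Longrightarrow> simple_graph (edgeless_graph n)"
  by (rule simple_graphI) (auto simp: edgeless_graph_def lessThan_empty_iff)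

lemma chromatic_number_edgeless_graph:
  assumes "n \<ge> 1"
  shows "chromatic_number (edgeless_graph n) = 1"
proof (rule chromatic_number_eqI)
  show "proper_coloring (edgeless_graph n) 1 (\<lambda>_. 1)"
    by (auto simp: proper_coloring_def edgeless_graph_def)
  fix l d
  assume "proper_coloring (edgeless_graph n) l d"
  then have "d ` {..<n} \<subseteq> {1..l}"
    by (simp add: proper_coloring_def edgeless_graph_def)
  then have "d 0 \<in> {1..l}"
    using assms by (auto simp del: atLeastAtMost_iff)
  then show "1 \<le> l" by simp
qed

text \<open>The partition into singletons reaches \<open>n\<close>, and nonempty disjoint classes
  cannot outnumber the vertices.\<close>

lemma FAT_chromatic_number_edgeless_graph:
  assumes "n \<ge> 1"
  shows "FAT_chromatic_number (edgeless_graph n) = n"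
proof (rule FAT_chromatic_number_eqI)
  show simple: "simple_graph (edgeless_graph n)"
    using assms by (rule simple_graph_edgeless_graph)
  \<comment> \<open>Colors start at 1 and vertices at 0, so class \<open>i\<close> is
    \<open>{i - 1}\<close>; the truncated subtraction is injective on \<open>{1..n}\<close>.\<close>
  have "x \<in> (\<lambda>i. i - 1) ` {1..n}" if "x < n" for x
    using that by (intro image_eqI[of _ _ "Suc x"]) auto
  then have "(\<Union>i\<in>{1..n}. {i - 1}) = {..<n}"
    by fastforce
  moreover have "disjoint_family_on (\<lambda>i. {i - 1}) {1..n}"
    by (auto simp: disjoint_family_on_def)
  ultimately show "FAT_coloring (edgeless_graph n) n (\<lambda>i. {i - 1})"
    by (auto simp: FAT_coloring_def edgeless_graph_def edges_to_def deg_def neighbors_def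
        intro!: bexI[of _ "0::real"])
  show "l \<le> n" if "FAT_coloring (edgeless_graph n) l W" for l W
    using FAT_coloring_le_card[OF simple that] by (simp add: edgeless_graph_def)
qed

text \<open>The clique is \<open>{..<n}\<close> and the leaf \<open>n\<close> hangs on
  \<open>0\<close>, so \<open>0\<close> is adjacent to every other vertex.\<close>

definition pendant_complete_graph :: "nat \<Rightarrow> nat pair_pre_digraph" where
  "pendant_complete_graph n =
     \<lparr>pverts = {..n}, parcs = {(i, j). i < n \<and> j < n \<and> i \<noteq> j} \<union> {(0, n), (n, 0)}\<rparr>"

lemma simple_graph_pendant_complete_graph:
  "n \<ge> 1 \<Longrightarrow> simple_graph (pendant_complete_graph n)"
  by (rule simple_graphI) (auto simp: pendant_complete_graph_def)

lemma chromatic_number_pendant_complete_graph: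
  assumes "n \<ge> 2"
  shows "chromatic_number (pendant_complete_graph n) = n"
proof (rule chromatic_number_eqI)
  \<comment> \<open>The leaf reuses the color 2 of vertex \<open>1\<close>; its only neighbor
    \<open>0\<close> has color 1.\<close>
  show "proper_coloring (pendant_complete_graph n) n (\<lambda>i. if i = n then 2 else Suc i)"
    using assms by (auto simp: proper_coloring_def pendant_complete_graph_def)
  fix l d
  assume "proper_coloring (pendant_complete_graph n) l d"
  then have range: "d ` {..n} \<subseteq> {1..l}"
    and proper: "\<And>u v. u < n \<Longrightarrow> v < n \<Longrightarrow> u \<noteq> v \<Longrightarrow> d u \<noteq> d v"
    by (auto simp: proper_coloring_def pendant_complete_graph_def)
  have "inj_on d {..<n}"
    using proper by (metis inj_onI lessThan_iff)
  moreover have "d ` {..<n} \<subseteq> {1..l}"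
    using range by fastforce
  ultimately have "card {..<n} \<le> card {1..l}"
    by (rule card_inj_on_le) simp
  then show "n \<le> l" by simp
qed

lemma FAT_chromatic_number_pendant_complete_graph:
  assumes "n \<ge> 3"
  shows "FAT_chromatic_number (pendant_complete_graph n) = 1"
proof (rule FAT_chromatic_number_eqI)
  let ?G = "pendant_complete_graph n"
  show simple: "simple_graph ?G"
    using assms by (intro simple_graph_pendant_complete_graph) simp
  show "FAT_coloring ?G 1 (\<lambda>_. pverts ?G)"
    using simple by (rule simple_graph_FAT_1_coloring)
  fix k V
  assume FAT: "FAT_coloring ?G k V"
  have verts: "pverts ?G = {..n}"
    by (simp add: pendant_complete_graph_def)
  have N_n: "neighbors ?G n = {0}"
    using assms by (auto simp: neighbors_def pendant_complete_graph_def)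
  have N_0: "neighbors ?G 0 = {1..n}"
    using assms by (auto simp: neighbors_def pendant_complete_graph_def)
  have N_1: "2 \<in> neighbors ?G 1" "finite (neighbors ?G 1)"
    using assms by (auto simp: neighbors_def pendant_complete_graph_def)
  show "k \<le> 1"
  proof (rule ccontr)
    assume "\<not> k \<le> 1"
    have nonempty: "\<And>i. i \<in> {1..k} \<Longrightarrow> V i \<noteq> {}"
      and disj: "\<And>i j. i \<in> {1..k} \<Longrightarrow> j \<in> {1..k} \<Longrightarrow> i \<noteq> j \<Longrightarrow> V i \<inter> V j = {}"
      and union: "(\<Union>i \<in> {1..k}. V i) = {..n}"
      using FAT verts by (auto simp: FAT_coloring_def disjoint_family_on_def)
    obtain \<alpha> \<beta> :: real where "\<forall>v \<in> pverts ?G. \<forall>i \<in> {1..k}.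
        (v \<notin> V i \<longrightarrow> real (edges_to ?G v (V i)) = \<alpha> * real (deg ?G v)) \<and>
        (v \<in> V i \<longrightarrow> real (edges_to ?G v (V i)) = \<beta> * real (deg ?G v))"
      using FAT unfolding FAT_coloring_def by blast
    then have
      out: "\<And>v i. v \<le> n \<Longrightarrow> i \<in> {1..k} \<Longrightarrow> v \<notin> V i \<Longrightarrow>
        real (edges_to ?G v (V i)) = \<alpha> * real (deg ?G v)" and
      ins: "\<And>v i. v \<le> n \<Longrightarrow> i \<in> {1..k} \<Longrightarrow> v \<in> V i \<Longrightarrow>
        real (edges_to ?G v (V i)) = \<beta> * real (deg ?G v)"
      unfolding verts by blast+
    obtain i where i: "i \<in> {1..k}" "n \<in> V i"
      using union by blast
    obtain j where j: "j \<in> {1..k}" "0 \<in> V j"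
      using union by blast
    show False
    \<comment> \<open>The split is on whether the leaf shares its class with its only neighbor
      \<open>0\<close>.\<close>
    proof (cases "i = j")
      case True
      \<comment> \<open>One of the classes 1 and 2 differs from class \<open>i\<close>.\<close>
      obtain l where l: "l \<in> {1..k}" "l \<noteq> i"
        using \<open>\<not> k \<le> 1\<close> that[of 1] that[of 2] by (cases "i = 1") auto
      have disj_l: "V l \<inter> V i = {}"
        using disj l i by blast
      then have "0 \<notin> V l" "n \<notin> V l"
        using i j True by auto
      have "V l \<inter> {0} = {}"
        using \<open>0 \<notin> V l\<close> by blast
      \<comment> \<open>The leaf has degree 1 and no neighbor in \<open>V l\<close>.\<close>
      then have "\<alpha> = 0"
        using out[of n l] l \<open>n \<notin> V l\<close> by (simp add: edges_to_def deg_def N_n)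
      \<comment> \<open>Vertex \<open>0\<close> has no neighbor in \<open>V l\<close>, yet it is
        adjacent to all other vertices, so nothing is left for \<open>V l\<close>.\<close>
      then have "V l \<inter> {1..n} = {}"
        using out[of 0 l] l \<open>0 \<notin> V l\<close> by (simp add: edges_to_def N_0)
      moreover have "V l \<subseteq> insert 0 {1..n}"
        using union l by fastforce
      ultimately show False
        using nonempty l \<open>0 \<notin> V l\<close> by blast
    next
      case False
      have disj_ij: "V i \<inter> V j = {}"
        using disj i j False by blast
      then have "V i \<inter> {0} = {}" "V j \<inter> {0} = {0}" "n \<notin> V j" "0 \<notin> V i"
        using i j by auto
      \<comment> \<open>The leaf has no neighbor in its own class, and its single neighbor lies in
        \<open>V j\<close>.\<close>
      then have "\<beta> = 0" "\<alpha> = 1"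
        using ins[of n i] out[of n j] i j by (simp_all add: edges_to_def deg_def N_n)
      \<comment> \<open>Since \<alpha> = 1, all neighbors of \<open>0\<close> lie in
        \<open>V i\<close>; this puts every vertex but \<open>0\<close> there.\<close>
      then have "card (V i \<inter> {1..n}) = card {1..n}"
        using out[of 0 i] i \<open>0 \<notin> V i\<close> by (simp add: edges_to_def deg_def N_0)
      then have "V i \<inter> {1..n} = {1..n}"
        by (intro card_subset_eq) auto
      then have "{1..n} \<subseteq> V i"
        by blast
      then have "1 \<in> V i" "2 \<in> V i"
        using assms by auto
      \<comment> \<open>\<beta> = 0 forbids neighbors inside a class, but \<open>1\<close> and
        \<open>2\<close> are adjacent because \<open>n \<ge> 3\<close> puts both in the
        clique.\<close>
      then have "V i \<inter> neighbors ?G 1 = {}"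
        using ins[of 1 i] i assms \<open>\<beta> = 0\<close> N_1 by (simp add: edges_to_def)
      then show False
        using \<open>2 \<in> V i\<close> N_1 by blast
    qed
  qed
qed

theorem theorem3p1:
  fixes n :: nat
  assumes "n \<ge> 3"
  shows "\<exists>(G1 :: nat pair_pre_digraph) (G2 :: nat pair_pre_digraph).
           simple_graph G1 \<and> simple_graph G2 \<and>
           chromatic_number G1 = 1 \<and> FAT_chromatic_number G1 = n \<and>
           chromatic_number G2 = n \<and> FAT_chromatic_number G2 = 1"
proof (intro exI conjI)
  show "simple_graph (edgeless_graph n)" "simple_graph (pendant_complete_graph n)"
    using assms by (simp_all add: simple_graph_edgeless_graph simple_graph_pendant_complete_graph)
  show "chromatic_number (edgeless_graph n) = 1" "FAT_chromatic_number (edgeless_graph n) = n"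
    using assms by (simp_all add: chromatic_number_edgeless_graph FAT_chromatic_number_edgeless_graph)
  show "chromatic_number (pendant_complete_graph n) = n"
    using assms by (simp add: chromatic_number_pendant_complete_graph)
  show "FAT_chromatic_number (pendant_complete_graph n) = 1"
    using assms by (rule FAT_chromatic_number_pendant_complete_graph)
qed

end
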